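(* Let $\beta\in(1,2)$. Then Lebesgue almost every $x\in I_\beta=\left[0,\frac{1}{\beta-1}\right]$ has a simply normal $\beta$-expansion.
   Context: For $\beta\in(1,2]$ and $x\in I_\beta:=\left[0,\frac{1}{\beta-1}\right]$, a sequence $(\epsilon_i)_{i\ge1}\in\{0,1\}^{\mathbb N}$ is called a $\beta$-expansion of $x$ if $x=\sum_{i=1}^\infty \frac{\epsilon_i}{\beta^i}$. The frequency of zeros of a sequence $(\epsilon_i)\in\{0,1\}^{\mathbb N}$ is the limit $\lim_{n\to\infty}\frac{\#\{1\le i\le n:\epsilon_i=0\}}{n}$, when this limit exists. The sequence $(\epsilon_i)$ is simply normal if its frequency of zeros exists and equals $1/2$. *)

theory Defs
  imports "HOL-Analysis.Analysis"
begin

text \<open>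
  Sequences \<open>(\<epsilon>\<^sub>i)\<close> with \<open>i \<ge> 1\<close> are represented as functions on \<^typ>\<open>nat\<close>; the value at
  index \<open>0\<close> is not a term of the sequence, and none of the definitions below depends on it.
\<close>

definition beta_interval :: "real \<Rightarrow> real set" where
  "beta_interval \<beta> = {0..1 / (\<beta> - 1)}"

definition binary_seq :: "(nat \<Rightarrow> nat) \<Rightarrow> bool" where
  "binary_seq \<epsilon> \<longleftrightarrow> (\<forall>i\<ge>1. \<epsilon> i \<in> {0, 1})"

definition beta_expansion :: "real \<Rightarrow> real \<Rightarrow> (nat \<Rightarrow> nat) \<Rightarrow> bool" where
  "beta_expansion \<beta> x \<epsilon> \<longleftrightarrow>
     binary_seq \<epsilon> \<and> (\<lambda>i. real (\<epsilon> (Suc i)) / \<beta> ^ Suc i) sums x"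

definition has_zero_frequency :: "(nat \<Rightarrow> nat) \<Rightarrow> real \<Rightarrow> bool" where
  "has_zero_frequency \<epsilon> p \<longleftrightarrow>
     (\<lambda>n. real (card {i. 1 \<le> i \<and> i \<le> n \<and> \<epsilon> i = 0}) / real n) \<longlonglongrightarrow> p"

definition simply_normal :: "(nat \<Rightarrow> nat) \<Rightarrow> bool" where
  "simply_normal \<epsilon> \<longleftrightarrow> has_zero_frequency \<epsilon> (1 / 2)"

end

theory Submission
  imports Defs
begin

text \<open>
  Let \<open>L = 1 / (\<beta> - 1)\<close>, so that the interval in question is \<open>I = [0, L]\<close>. A finite word \<open>w\<close> of
  digits acts on \<open>I\<close> by the contraction \<open>cyl w\<close>, and its image, the cylinder of \<open>w\<close>, consists
  of the points that have an expansion starting with \<open>w\<close>; its length is \<open>L / \<beta> ^ |w|\<close>. An expansion of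
  \<open>x\<close> can be built blockwise: if a finite set \<open>V\<close> of words has cylinders covering \<open>I\<close>, then \<open>x\<close>
  can spend a block \<open>w \<in> V\<close> and continue with a new point of \<open>I\<close>, where again any cover may be used.

  If the cylinders of \<open>V\<close> were disjoint, the blocks of a uniformly distributed point would be
  independent and have probabilities \<open>\<beta> ^ -|w|\<close>. If moreover \<open>V\<close> were closed under exchanging
  the two digits, the excess of zeros over ones in a block would have mean zero, and the law of large
  numbers would give the frequency \<open>1/2\<close>. Disjointness can be weakened to near-optimality: it
  suffices that the total weight \<open>\<Sum>w\<in>V. \<beta> ^ -|w|\<close> exceeds \<open>1\<close> by a small amount. Then the union
  bound over words takes the place of the exact computation of probabilities.

  Such covers are produced by repeatedly filling gaps (\<open>gap_cover\<close>): put a cylinder of at least a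
  quarter of the length into each gap, and after \<open>m\<close> rounds cover the remaining gaps by cylinders of
  comparable length. The total length of what remains shrinks like \<open>(3/4) ^ m\<close>, so the waste becomes
  arbitrarily small, while the sum of the powers \<open>3/4\<close> of the lengths stays bounded independently
  of \<open>m\<close>. The latter says that long blocks are exponentially rare. Covering the left half of \<open>I\<close>
  and reflecting gives the symmetric covers (\<open>symmetric_cover\<close>). The reflection of a cylinder is
  again a cylinder, so the symmetry costs nothing.

  Take a cover with waste at most \<open>2 ^ -i\<close> for the \<open>i\<close>-th block. Chernoff's method
  shows that the concatenations of \<open>n\<close> blocks whose excess is larger than \<open>\<epsilon> n\<close> in absolute
  value have exponentially small total weight, and so have the concatenations of \<open>n\<close> blocks and a
  further block longer than \<open>\<epsilon> n\<close>.
  By Borel and Cantelli, almost every \<open>x\<close> lies in only finitely many of these bad cylinders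
  (\<open>AE_unbalanced\<close>, \<open>AE_long_step\<close>). For such an \<open>x\<close> every choice of blocks yields a simply normal
  expansion (\<open>balanced_expansion\<close>): the excess is small at the ends of blocks, and between
  them it changes by at most the length of one block.
\<close>

section \<open>Words and cylinders\<close>

locale beta_base =
  fixes \<beta> :: real
  assumes gt1: "1 < \<beta>" and lt2: "\<beta> < 2"
begin

definition L :: real where "L = 1 / (\<beta> - 1)"

primrec cyl :: "bool list \<Rightarrow> real \<Rightarrow> real" where
  "cyl [] y = y"
| "cyl (d # w) y = (of_bool d + cyl w y) / \<beta>"

definition cylinder :: "bool list \<Rightarrow> real set" where
  "cylinder w = cyl w ` {0..L}"

definition wt :: "bool list \<Rightarrow> real" where
  "wt w = 1 / \<beta> ^ length w"

lemma beta_pos: "0 < \<beta>" using gt1 by simp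

lemma L_pos: "0 < L" using gt1 by (simp add: L_def)

lemma L_scale: "\<beta> * L = L + 1"
  using gt1 by (simp add: L_def field_simps)

lemma L_gt1: "1 < L" using gt1 lt2 by (simp add: L_def field_simps)

lemma wt_pos: "0 < wt w" using beta_pos by (simp add: wt_def)

lemma wt_le1: "wt w \<le> 1" using gt1 by (simp add: wt_def)

lemma wt_Nil [simp]: "wt [] = 1" by (simp add: wt_def)

lemma wt_append: "wt (u @ w) = wt u * wt w"
  by (simp add: wt_def power_add)

lemma cyl_append: "cyl (u @ w) y = cyl u (cyl w y)"
  by (induction u) auto

lemma cyl_affine: "cyl w y = cyl w 0 + y * wt w"
  using beta_pos by (induction w) (auto simp: wt_def field_simps)

text \<open>
  The point reflection of the interval exchanges the digits because \<open>\<beta> L = L + 1\<close>.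
\<close>

lemma cyl_flip: "cyl (map Not w) (L - y) = L - cyl w y"
proof (induction w)
  case (Cons d w)
  have "of_bool (\<not> d) + (L - cyl w y) = \<beta> * L - (of_bool d + cyl w y)"
    by (simp add: L_scale)
  then have "cyl (map Not (d # w)) (L - y) = (\<beta> * L - (of_bool d + cyl w y)) / \<beta>"
    using Cons by simp
  also have "\<dots> = L - cyl (d # w) y" using beta_pos by (simp add: diff_divide_distrib)
  finally show ?case .
qed simp

lemma cylinder_interval: "cylinder w = {cyl w 0 .. cyl w 0 + L * wt w}"
proof
  show "cylinder w \<subseteq> {cyl w 0 .. cyl w 0 + L * wt w}"
  proof
    fix z assume "z \<in> cylinder w"
    then obtain y where y: "0 \<le> y" "y \<le> L" "z = cyl w y" by (auto simp: cylinder_def)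
    then have "y * wt w \<le> L * wt w" "0 \<le> y * wt w"
      using wt_pos[of w] by (auto intro: mult_right_mono)
    then show "z \<in> {cyl w 0 .. cyl w 0 + L * wt w}"
      using y cyl_affine[of w y] by auto
  qed
next
  show "{cyl w 0 .. cyl w 0 + L * wt w} \<subseteq> cylinder w"
  proof
    fix z assume z: "z \<in> {cyl w 0 .. cyl w 0 + L * wt w}"
    define y where "y = (z - cyl w 0) / wt w"
    have "y \<in> {0..L}" using z wt_pos[of w] by (auto simp: y_def field_simps)
    moreover have "z = cyl w y"
      using cyl_affine[of w y] wt_pos[of w] by (simp add: y_def)
    ultimately show "z \<in> cylinder w" by (auto simp: cylinder_def)
  qed
qed

lemma cylinder_Cons_iff: "z \<in> cylinder (d # w) \<longleftrightarrow> \<beta> * z - of_bool d \<in> cylinder w"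
  using beta_pos by (auto simp: cylinder_def field_simps image_iff)

lemma cyl_mem: "y \<in> {0..L} \<Longrightarrow> cyl w y \<in> {0..L}"
proof (induction w)
  case (Cons d w)
  then have "0 \<le> of_bool d + cyl w y" "of_bool d + cyl w y \<le> L * \<beta>"
    using L_scale by (auto simp: mult.commute of_bool_def)
  then show ?case using beta_pos by (simp add: field_simps)
qed simp

lemma cylinder_flip:
  assumes "z \<in> cylinder w" shows "L - z \<in> cylinder (map Not w)"
proof -
  from assms obtain y where y: "y \<in> {0..L}" "z = cyl w y" by (auto simp: cylinder_def)
  have "L - y \<in> {0..L}" using y by auto
  then show ?thesis using cyl_flip[of w y] y by (auto simp: cylinder_def image_iff intro!: bexI[of _ "L - y"])
qed

text \<open>
  The maps \<open>y \<mapsto> \<beta> y\<close> and \<open>y \<mapsto> \<beta> y - 1\<close> keep the points of \<open>[0, L / \<beta>]\<close> and of \<open>[1 / \<beta>, L]\<close>,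
  respectively, in \<open>[0, L]\<close>. Since \<open>\<beta> < 2\<close>, these two intervals together make up \<open>[0, L]\<close>, so a next
  digit can always be chosen.
\<close>

lemma point_in_cylinder:
  "y \<in> {0..L} \<Longrightarrow> \<exists>w. length w = n \<and> y \<in> cylinder w"
proof (induction n arbitrary: y)
  case 0
  then show ?case by (auto simp: cylinder_def)
next
  case (Suc n)
  define d where "d \<longleftrightarrow> L < \<beta> * y"
  have "\<beta> * y \<le> \<beta> * L" using Suc.prems beta_pos by auto
  then have "\<beta> * y - of_bool d \<in> {0..L}"
    using Suc.prems beta_pos L_gt1 L_scale by (auto simp: d_def)
  then obtain w where "length w = n" "\<beta> * y - of_bool d \<in> cylinder w" using Suc.IH by blast
  then show ?case by (intro exI[of _ "d # w"]) (simp add: cylinder_Cons_iff)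
qed

text \<open>
  The length of \<open>[1 / \<beta>, L / \<beta>]\<close>, on which both digits are possible. It is positive because \<open>\<beta> < 2\<close>.
\<close>

definition overlap :: real where "overlap = (L - 1) / \<beta>"

lemma overlap_pos: "0 < overlap" using L_gt1 beta_pos by (simp add: overlap_def)

text \<open>
  An interval no longer than the overlap lies in one of the two cylinders of length-one words, so the same
  digit can be chosen for all its points. Expanding by this digit multiplies the length by \<open>\<beta>\<close>, and
  the step can be repeated until the interval is longer than the overlap.
\<close>

lemma interval_in_cylinder:
  "\<lbrakk>0 \<le> a; a \<le> b; b \<le> L; b - a \<le> overlap * \<beta> / \<beta> ^ n\<rbrakk>
     \<Longrightarrow> \<exists>w. length w = n \<and> {a..b} \<subseteq> cylinder w"
proof (induction n arbitrary: a b)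
  case 0
  then show ?case by (auto simp: cylinder_def)
next
  case (Suc n)
  define d where "d \<longleftrightarrow> L < \<beta> * b"
  have len: "\<beta> * b - \<beta> * a \<le> overlap * \<beta> / \<beta> ^ n"
  proof -
    have "\<beta> * (b - a) \<le> \<beta> * (overlap * \<beta> / \<beta> ^ Suc n)"
      using Suc.prems(4) beta_pos by (intro mult_left_mono) auto
    also have "\<dots> = overlap * \<beta> / \<beta> ^ n" using beta_pos by simp
    finally show ?thesis by (simp add: algebra_simps)
  qed
  have "overlap * \<beta> / \<beta> ^ n \<le> L - 1"
    using gt1 L_gt1 by (simp add: overlap_def divide_le_eq mult_le_cancel_left1)
  then have short: "\<beta> * b - \<beta> * a \<le> L - 1" using len by linarith
  have "\<beta> * b \<le> \<beta> * L" "0 \<le> \<beta> * a" "\<beta> * a \<le> \<beta> * b" using Suc.prems beta_pos by auto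
  then have "0 \<le> \<beta> * a - of_bool d" "\<beta> * a - of_bool d \<le> \<beta> * b - of_bool d"
      "\<beta> * b - of_bool d \<le> L" "(\<beta> * b - of_bool d) - (\<beta> * a - of_bool d) \<le> overlap * \<beta> / \<beta> ^ n"
    using short L_scale len by (auto simp: d_def of_bool_def)
  then obtain w where w: "length w = n"
      "{\<beta> * a - of_bool d .. \<beta> * b - of_bool d} \<subseteq> cylinder w"
    using Suc.IH by blast
  have "{a..b} \<subseteq> cylinder (d # w)"
  proof
    fix z assume "z \<in> {a..b}"
    then have "\<beta> * a \<le> \<beta> * z" "\<beta> * z \<le> \<beta> * b" using beta_pos by auto
    then show "z \<in> cylinder (d # w)" using w(2) by (auto simp: cylinder_Cons_iff)
  qed
  then show ?case using w(1) by (intro exI[of _ "d # w"]) simp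
qed

lemma threshold_exponent:
  assumes "0 < t" "t < c"
  obtains n where "c / \<beta> ^ Suc n \<le> t" "t < c / \<beta> ^ n"
proof -
  obtain k where "c / t < \<beta> ^ k" using real_arch_pow[OF gt1] by blast
  then have ex: "c / \<beta> ^ k \<le> t" using assms beta_pos by (simp add: field_simps)
  define n where "n = (LEAST k. c / \<beta> ^ k \<le> t)"
  have n: "c / \<beta> ^ n \<le> t" unfolding n_def using ex by (rule LeastI)
  then have "n \<noteq> 0" using assms by (auto intro!: Nat.gr0I)
  then obtain m where m: "n = Suc m" by (cases n) auto
  have "\<not> c / \<beta> ^ m \<le> t" using not_less_Least[of m "\<lambda>k. c / \<beta> ^ k \<le> t"] m n_def by simp
  then show thesis using that[of m] n m by auto
qed

text \<open>
  Take the first \<open>n\<close> for which cylinders of words of length \<open>n\<close> are at most half as long as the interval. One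
  of them contains the midpoint, hence lies inside; by minimality of \<open>n\<close> its length is at least
  \<open>(b - a) / (2 \<beta>)\<close>.
\<close>

lemma inner_cylinder:
  assumes "0 \<le> a" "a < b" "b \<le> L"
  obtains w where "w \<noteq> []" "cylinder w \<subseteq> {a..b}" "(b - a) / 4 \<le> L * wt w"
proof -
  obtain n where n: "L / \<beta> ^ Suc n \<le> (b - a) / 2" "(b - a) / 2 < L / \<beta> ^ n"
    using threshold_exponent[of "(b - a) / 2" L] assms by auto
  have "(a + b) / 2 \<in> {0..L}" using assms by auto
  then obtain w where w: "length w = Suc n" "(a + b) / 2 \<in> cylinder w"
    using point_in_cylinder by blast
  have lw: "L * wt w = L / \<beta> ^ Suc n" by (simp add: wt_def w)
  have "(b - a) / 2 / 2 \<le> (b - a) / 2 / \<beta>"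
    using lt2 gt1 assms by (intro divide_left_mono) auto
  then have "(b - a) / 4 \<le> (b - a) / 2 / \<beta>" by simp
  also have "\<dots> \<le> (L / \<beta> ^ n) / \<beta>" using n(2) beta_pos by (intro divide_right_mono) auto
  also have "\<dots> = L * wt w" using beta_pos by (simp add: lw)
  finally have "(b - a) / 4 \<le> L * wt w" .
  moreover have "cylinder w \<subseteq> {a..b}"
  proof -
    define s where "s = L * wt w"
    have "s \<le> (b - a) / 2" using n(1) lw by (simp add: s_def)
    moreover have "(a + b) / 2 \<in> {cyl w 0..cyl w 0 + s}"
      using w(2) unfolding cylinder_interval s_def .
    ultimately show ?thesis unfolding cylinder_interval s_def[symmetric] by auto
  qed
  moreover have "w \<noteq> []" using w(1) by auto
  ultimately show thesis using that by blast
qed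

text \<open>
  Short intervals lie in a single cylinder of comparable length by \<open>interval_in_cylinder\<close>.
  Two words are only needed for intervals longer than the overlap. These are covered by all words of length one; a
  single word containing them could be forced to be empty, which would be useless as a block.
\<close>

lemma outer_cylinders:
  assumes "0 \<le> a" "a < b" "b \<le> L"
  obtains V where "finite V" "card V \<le> 2" "[] \<notin> V" "{a..b} \<subseteq> (\<Union>w\<in>V. cylinder w)"
    "\<And>w. w \<in> V \<Longrightarrow> L * wt w \<le> L / overlap * (b - a)"
proof (cases "b - a < overlap")
  case True
  then have "b - a < overlap * 1" by simp
  then obtain n where n: "overlap / \<beta> ^ Suc n \<le> b - a" "b - a < overlap / \<beta> ^ n"
    using threshold_exponent[of "b - a" overlap] assms by auto
  have "overlap * \<beta> / \<beta> ^ Suc n = overlap / \<beta> ^ n" using beta_pos by simp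
  then obtain w where w: "length w = Suc n" "{a..b} \<subseteq> cylinder w"
    using interval_in_cylinder[of a b "Suc n"] assms n(2) by auto
  have "wt w * overlap \<le> b - a" using n(1) by (simp add: wt_def w)
  then have "L / overlap * (wt w * overlap) \<le> L / overlap * (b - a)"
    using overlap_pos L_pos by (intro mult_left_mono) auto
  then have "L * wt w \<le> L / overlap * (b - a)" using overlap_pos by simp
  then show thesis using w by (intro that[of "{w}"]) auto
next
  case False
  have "{a..b} \<subseteq> (\<Union>w\<in>{[False], [True]}. cylinder w)"
  proof
    fix y assume "y \<in> {a..b}"
    then have "y \<in> {0..L}" using assms by auto
    then obtain w where "length w = Suc 0" "y \<in> cylinder w" using point_in_cylinder by blast
    then show "y \<in> (\<Union>w\<in>{[False], [True]}. cylinder w)"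
      by (auto simp: length_Suc_conv) (metis (full_types))
  qed
  moreover have "L * wt w \<le> L / overlap * (b - a)" for w
  proof -
    have "L * wt w \<le> L * 1" using wt_le1[of w] L_pos by (intro mult_left_mono) auto
    also have "\<dots> \<le> L * ((b - a) / overlap)"
      using False overlap_pos L_pos by (intro mult_left_mono) (auto simp: field_simps)
    finally show ?thesis by simp
  qed
  ultimately show thesis by (intro that[of "{[False], [True]}"]) auto
qed

section \<open>Efficient covers by cylinders\<close>

definition \<rho> :: real where "\<rho> = (27 / 32) powr (1 / 4)"

lemma rho: "0 < \<rho>" "\<rho> < 1"
  using powr_less_mono2[of "1/4" "27/32" 1] by (auto simp: \<rho>_def)

text \<open>
  The graph of the concave function \<open>x powr (3 / 4)\<close> lies below its tangent at \<open>m\<close>.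
\<close>

lemma powr_three_quarters_tangent:
  fixes x m :: real
  assumes "0 \<le> x" "0 < m"
  shows "x powr (3 / 4) \<le> (3 / 4 * x + m / 4) / m powr (1 / 4)"
proof -
  have "x powr (3 / 4) * m powr (1 / 4) \<le> (3 / 4) * x + (1 / 4) * m"
    using Youngs_inequality_0[of "3/4" "1/4" x m] assms by (cases "x = 0") auto
  then show ?thesis using assms by (simp add: field_simps)
qed

text \<open>
  The constant \<open>\<rho> < 1\<close> is what makes gap filling efficient: replacing a gap of length \<open>l\<close> by two gaps
  of total length at most \<open>3 l / 4\<close> decreases the sum of the powers \<open>3/4\<close>. By concavity the worst case
  is that of two gaps of length \<open>3 l / 8\<close>, and \<open>2 (3 / 8) powr (3 / 4) = \<rho>\<close>.
\<close>

lemma powr_three_quarters_split: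
  fixes x y l :: real
  assumes "0 \<le> x" "0 \<le> y" "0 < l" "x + y \<le> 3 / 4 * l"
  shows "x powr (3 / 4) + y powr (3 / 4) \<le> \<rho> * l powr (3 / 4)"
proof -
  \<comment> \<open>Both powers are bounded by the tangent at the extremal point.\<close>
  define m where "m = 3 / 8 * l"
  have m: "0 < m" using assms by (simp add: m_def)
  have "x powr (3 / 4) + y powr (3 / 4)
      \<le> (3 / 4 * x + m / 4) / m powr (1 / 4) + (3 / 4 * y + m / 4) / m powr (1 / 4)"
    using powr_three_quarters_tangent m assms by (intro add_mono) auto
  also have "\<dots> = (3 / 4 * (x + y) + m / 2) / m powr (1 / 4)"
    unfolding add_divide_distrib[symmetric] by (rule arg_cong[of _ _ "\<lambda>t. t / m powr (1 / 4)"]) simp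
  also have "\<dots> \<le> (2 * m) / m powr (1 / 4)"
  proof (rule divide_right_mono)
    show "3 / 4 * (x + y) + m / 2 \<le> 2 * m" using assms(4) unfolding m_def by argo
  qed simp
  also have "\<dots> = 2 * m powr (3 / 4)"
    using m powr_diff[of m 1 "1/4"] by simp
  also have "\<dots> = 2 * ((3 / 8) powr (3 / 4) * l powr (3 / 4))"
    unfolding m_def using assms by (subst powr_mult) auto
  also have "2 * (3 / 8 :: real) powr (3 / 4) = \<rho>"
  proof -
    have "(3 / 8 :: real) powr (3 / 4) = ((3 / 8) powr 3) powr (1 / 4)" by (simp only: powr_powr) simp
    also have "(3 / 8 :: real) powr 3 = 27 / 512" by (simp add: powr_numeral power3_eq_cube)
    finally have 1: "(3 / 8 :: real) powr (3 / 4) = (27 / 512) powr (1 / 4)" .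
    have "(2 :: real) = (2 powr 4) powr (1 / 4)" by (simp only: powr_powr) simp
    also have "(2 :: real) powr 4 = 16" by (simp add: powr_numeral)
    finally have 2: "(2 :: real) = 16 powr (1 / 4)" .
    have "2 * (3 / 8 :: real) powr (3 / 4) = 16 powr (1 / 4) * (27 / 512) powr (1 / 4)"
      using 1 2 by simp
    also have "\<dots> = (16 * (27 / 512)) powr (1 / 4)" by (subst powr_mult) auto
    also have "\<dots> = \<rho>" by (simp add: \<rho>_def)
    finally show ?thesis .
  qed
  then have "2 * ((3 / 8) powr (3 / 4) * l powr (3 / 4)) = \<rho> * l powr (3 / 4)"
    by (simp add: mult.assoc[symmetric])
  finally show ?thesis .
qed

text \<open>
  The constants of the gap filling: \<open>C0\<close> bounds the waste of covering a gap directly by two outer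
  cylinders; \<open>D0\<close> is large enough for that direct cover and for the induction step, which
  needs \<open>1 + D0 \<rho> \<le> D0\<close>.
\<close>

definition C0 :: real where "C0 = 2 * (L / overlap)"
definition D0 :: real where "D0 = max (2 * (L / overlap) powr (3 / 4)) (1 / (1 - \<rho>))"

lemma C0_pos: "0 < C0" using L_pos overlap_pos by (simp add: C0_def)

lemma D0_step: "1 + D0 * \<rho> \<le> D0"
proof -
  have "1 / (1 - \<rho>) \<le> D0" by (simp add: D0_def)
  then have "1 \<le> D0 * (1 - \<rho>)" using rho by (simp add: field_simps)
  then show ?thesis by (simp add: algebra_simps)
qed

lemma D0_pos: "0 < D0" using rho by (simp add: D0_def less_max_iff_disj)

lemma sum_Un_le_nonneg:
  fixes f :: "'a \<Rightarrow> real"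
  assumes "finite A" "finite B" "\<And>x. 0 \<le> f x"
  shows "sum f (A \<union> B) \<le> sum f A + sum f B"
  using sum_Un[OF assms(1,2), of f] assms(3) by (simp add: sum_nonneg)

text \<open>
  Each round of filling puts a cylinder around the midpoint of the gap and treats the two remaining gaps by induction,
  where \<open>m\<close> is the number of rounds. Only the part of the gap that is left uncovered by
  the inner cylinders, a fraction of at most \<open>(3 / 4) ^ m\<close>, contributes waste. The bound on the powers
  \<open>3/4\<close> does not depend on \<open>m\<close>. The open interval is used because gaps may be degenerate.
\<close>

lemma gap_cover:
  assumes "0 \<le> a" "a \<le> b" "b \<le> L"
  shows "\<exists>V. finite V \<and> [] \<notin> V \<and> {a<..<b} \<subseteq> (\<Union>w\<in>V. cylinder w)
           \<and> (\<Sum>w\<in>V. L * wt w) \<le> (1 + C0 * (3 / 4) ^ m) * (b - a)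
           \<and> (\<Sum>w\<in>V. (L * wt w) powr (3 / 4)) \<le> D0 * (b - a) powr (3 / 4)"
    (is "\<exists>V. ?P m a b V")
  using assms
proof (induction m arbitrary: a b)
  case 0
  show ?case
  proof (cases "a < b")
    case False
    then show ?thesis using 0 by (intro exI[of _ "{}"]) auto
  next
    case True
    with 0 obtain V where V: "finite V" "card V \<le> 2" "[] \<notin> V" "{a..b} \<subseteq> (\<Union>w\<in>V. cylinder w)"
      "\<And>w. w \<in> V \<Longrightarrow> L * wt w \<le> L / overlap * (b - a)"
      using outer_cylinders by metis
    have nn: "0 \<le> L / overlap * (b - a)" using L_pos overlap_pos True by simp
    have "(\<Sum>w\<in>V. L * wt w) \<le> real (card V) * (L / overlap * (b - a))"
      using V(5) by (intro sum_bounded_above) auto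
    also have "\<dots> \<le> 2 * (L / overlap * (b - a))" using V(2) nn by (intro mult_right_mono) auto
    also have "\<dots> \<le> (1 + C0 * (3 / 4) ^ 0) * (b - a)" using True by (simp add: C0_def algebra_simps)
    finally have s1: "(\<Sum>w\<in>V. L * wt w) \<le> (1 + C0 * (3 / 4) ^ 0) * (b - a)" .
    have "(\<Sum>w\<in>V. (L * wt w) powr (3 / 4)) \<le> real (card V) * (L / overlap * (b - a)) powr (3 / 4)"
      using V(5) L_pos wt_pos by (intro sum_bounded_above powr_mono2) (auto simp: less_imp_le)
    also have "\<dots> \<le> 2 * (L / overlap * (b - a)) powr (3 / 4)" using V(2) by (intro mult_right_mono) auto
    also have "\<dots> = (2 * (L / overlap) powr (3 / 4)) * (b - a) powr (3 / 4)"
      using L_pos overlap_pos True by (subst powr_mult) auto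
    also have "\<dots> \<le> D0 * (b - a) powr (3 / 4)"
      by (intro mult_right_mono) (auto simp: D0_def)
    finally have s2: "(\<Sum>w\<in>V. (L * wt w) powr (3 / 4)) \<le> D0 * (b - a) powr (3 / 4)" .
    have "{a<..<b} \<subseteq> {a..b}" by auto
    then show ?thesis using V s1 s2 by (intro exI[of _ V]) blast
  qed
next
  case (Suc m)
  show ?case
  proof (cases "a < b")
    case False
    then show ?thesis using Suc.prems by (intro exI[of _ "{}"]) auto
  next
    case True
    with Suc.prems obtain w where w: "w \<noteq> []" "cylinder w \<subseteq> {a..b}" "(b - a) / 4 \<le> L * wt w"
      using inner_cylinder by metis
    define p q where "p = cyl w 0" and "q = cyl w 0 + L * wt w"
    have cw: "cylinder w = {p..q}" by (simp add: p_def q_def cylinder_interval)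
    have pq: "p \<le> q" "q - p = L * wt w"
      using L_pos wt_pos[of w] by (auto simp: p_def q_def less_imp_le)
    have apqb: "a \<le> p" "q \<le> b" using w(2) pq unfolding cw by auto
    obtain V1 where V1: "?P m a p V1" using Suc.IH[of a p] apqb pq Suc.prems by auto
    obtain V2 where V2: "?P m q b V2" using Suc.IH[of q b] apqb pq Suc.prems by auto
    define V where "V = insert w (V1 \<union> V2)"
    have sumV: "sum f V \<le> f w + (sum f V1 + sum f V2)" if "\<And>x. 0 \<le> f x" for f :: "bool list \<Rightarrow> real"
    proof -
      have "sum f V \<le> sum f {w} + sum f (V1 \<union> V2)"
        using sum_Un_le_nonneg[of "{w}" "V1 \<union> V2" f] that V1 V2 by (simp add: V_def)
      also have "sum f (V1 \<union> V2) \<le> sum f V1 + sum f V2"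
        using sum_Un_le_nonneg[of V1 V2 f] that V1 V2 by simp
      finally show ?thesis by simp
    qed
    have rest: "(p - a) + (b - q) \<le> 3 / 4 * (b - a)" using w(3) pq by simp
    have "(\<Sum>w\<in>V. L * wt w) \<le> L * wt w + ((\<Sum>w\<in>V1. L * wt w) + (\<Sum>w\<in>V2. L * wt w))"
      using L_pos wt_pos by (intro sumV) (auto simp: less_imp_le)
    also have "\<dots> \<le> (q - p) + ((1 + C0 * (3 / 4) ^ m) * (p - a) + (1 + C0 * (3 / 4) ^ m) * (b - q))"
      using V1 V2 pq by (intro add_mono) auto
    also have "\<dots> = (b - a) + C0 * (3 / 4) ^ m * ((p - a) + (b - q))" by (simp add: algebra_simps)
    also have "\<dots> \<le> (b - a) + C0 * (3 / 4) ^ m * (3 / 4 * (b - a))"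
      using rest C0_pos by (intro add_left_mono mult_left_mono) auto
    also have "\<dots> = (1 + C0 * (3 / 4) ^ Suc m) * (b - a)" by (simp add: algebra_simps)
    finally have s1: "(\<Sum>w\<in>V. L * wt w) \<le> (1 + C0 * (3 / 4) ^ Suc m) * (b - a)" .
    have "(\<Sum>w\<in>V. (L * wt w) powr (3 / 4)) \<le> (L * wt w) powr (3 / 4) +
        ((\<Sum>w\<in>V1. (L * wt w) powr (3 / 4)) + (\<Sum>w\<in>V2. (L * wt w) powr (3 / 4)))"
      by (intro sumV) auto
    also have "\<dots> \<le> (b - a) powr (3 / 4) + (D0 * (p - a) powr (3 / 4) + D0 * (b - q) powr (3 / 4))"
      using V1 V2 pq apqb L_pos wt_pos[of w] by (intro add_mono powr_mono2) (auto simp: less_imp_le)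
    also have "\<dots> = (b - a) powr (3 / 4) + D0 * ((p - a) powr (3 / 4) + (b - q) powr (3 / 4))"
      by (simp add: algebra_simps)
    also have "\<dots> \<le> (b - a) powr (3 / 4) + D0 * (\<rho> * (b - a) powr (3 / 4))"
      using rest apqb True D0_pos
      by (intro add_left_mono mult_left_mono powr_three_quarters_split) auto
    also have "\<dots> = (1 + D0 * \<rho>) * (b - a) powr (3 / 4)" by (simp add: algebra_simps)
    also have "\<dots> \<le> D0 * (b - a) powr (3 / 4)" using D0_step by (intro mult_right_mono) auto
    finally have s2: "(\<Sum>w\<in>V. (L * wt w) powr (3 / 4)) \<le> D0 * (b - a) powr (3 / 4)" .
    have "{a<..<b} \<subseteq> {a<..<p} \<union> cylinder w \<union> {q<..<b}" unfolding cw by auto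
    also have "\<dots> \<subseteq> (\<Union>w\<in>V. cylinder w)" using V1 V2 unfolding V_def by blast
    finally have "{a<..<b} \<subseteq> (\<Union>w\<in>V. cylinder w)" .
    moreover have "finite V" "[] \<notin> V" using V1 V2 w(1) by (auto simp: V_def)
    ultimately show ?thesis using s1 s2 by (intro exI[of _ V]) blast
  qed
qed

definition K0 :: real where "K0 = 2 * (D0 * (L / 2) powr (3 / 4)) / L powr (3 / 4)"

text \<open>
  Cover the left half, then add the reflected cylinders for the right half. The bound \<open>K0\<close> is independent of the
  waste \<open>\<delta>\<close>; this uniformity allows \<open>\<delta>\<close> to be chosen smaller from block to block.
\<close>

lemma symmetric_cover:
  assumes "0 < \<delta>"
  obtains V where "finite V" "[] \<notin> V" "map Not ` V = V" "{0..L} \<subseteq> (\<Union>w\<in>V. cylinder w)"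
    "(\<Sum>w\<in>V. wt w) \<le> 1 + \<delta>" "(\<Sum>w\<in>V. wt w powr (3 / 4)) \<le> K0"
proof -
  obtain m where m: "(3 / 4 :: real) ^ m < \<delta> / C0"
    using real_arch_pow_inv[of "\<delta> / C0" "3/4"] assms C0_pos by auto
  then have m: "C0 * (3 / 4) ^ m \<le> \<delta>" using C0_pos by (simp add: field_simps)
  obtain W where W: "finite W" "[] \<notin> W" "{0<..<L / 2} \<subseteq> (\<Union>w\<in>W. cylinder w)"
    "(\<Sum>w\<in>W. L * wt w) \<le> (1 + C0 * (3 / 4) ^ m) * (L / 2 - 0)"
    "(\<Sum>w\<in>W. (L * wt w) powr (3 / 4)) \<le> D0 * (L / 2 - 0) powr (3 / 4)"
    using gap_cover[of 0 "L / 2" m] L_pos by auto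
  define V where "V = W \<union> map Not ` W"
  have NN: "map Not (map Not w) = w" for w by (induction w) auto
  have inj: "inj_on (map Not) W" by (metis NN inj_on_inverseI)
  have wtN: "wt (map Not w) = wt w" for w by (simp add: wt_def)
  have sumV: "sum f V \<le> 2 * sum f W" if "\<And>x. 0 \<le> f x" "\<And>x. f (map Not x) = f x"
    for f :: "bool list \<Rightarrow> real"
    using sum_Un_le_nonneg[of W "map Not ` W" f] that W(1) sum.reindex[OF inj, of f]
    by (simp add: V_def)
  \<comment> \<open>A finite union of cylinders is closed, so it also contains the endpoints of the open interval.\<close>
  have half: "{0..L / 2} \<subseteq> (\<Union>w\<in>W. cylinder w)"
  proof -
    have "closed (\<Union>w\<in>W. cylinder w)"
      using W(1) by (intro closed_UN) (auto simp: cylinder_interval)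
    then have "closure {0<..<L / 2} \<subseteq> (\<Union>w\<in>W. cylinder w)"
      using W(3) by (intro closure_minimal)
    then show ?thesis using L_pos by (simp add: closure_greaterThanLessThan)
  qed
  have cov: "{0..L} \<subseteq> (\<Union>w\<in>V. cylinder w)"
  proof
    fix z assume z: "z \<in> {0..L}"
    show "z \<in> (\<Union>w\<in>V. cylinder w)"
    proof (cases "z \<le> L / 2")
      case True
      then have "z \<in> {0..L / 2}" using z by auto
      then show ?thesis using half unfolding V_def by blast
    next
      case False
      then have "L - z \<in> {0..L / 2}" using z by auto
      then obtain w where w: "w \<in> W" "L - z \<in> cylinder w" using half by blast
      then have "L - (L - z) \<in> cylinder (map Not w)" using cylinder_flip by blast
      then show ?thesis using w(1) by (auto simp: V_def)
    qed
  qed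
  have "L * (\<Sum>w\<in>V. wt w) = (\<Sum>w\<in>V. L * wt w)" by (simp add: sum_distrib_left)
  also have "\<dots> \<le> 2 * (\<Sum>w\<in>W. L * wt w)"
    using L_pos wt_pos by (intro sumV) (auto simp: wtN less_imp_le)
  also have "\<dots> \<le> L * (1 + C0 * (3 / 4) ^ m)" using W(4) by (simp add: algebra_simps)
  also have "\<dots> \<le> L * (1 + \<delta>)" using m L_pos by (intro mult_left_mono) auto
  finally have s1: "(\<Sum>w\<in>V. wt w) \<le> 1 + \<delta>" using L_pos by simp
  have "L powr (3 / 4) * (\<Sum>w\<in>V. wt w powr (3 / 4)) = (\<Sum>w\<in>V. (L * wt w) powr (3 / 4))"
    using L_pos wt_pos by (auto simp: sum_distrib_left powr_mult less_imp_le)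
  also have "\<dots> \<le> 2 * (\<Sum>w\<in>W. (L * wt w) powr (3 / 4))" by (intro sumV) (auto simp: wtN)
  also have "\<dots> \<le> 2 * (D0 * (L / 2) powr (3 / 4))" using W(5) by simp
  finally have s2: "(\<Sum>w\<in>V. wt w powr (3 / 4)) \<le> K0"
    using L_pos by (simp add: K0_def field_simps)
  have "map Not ` V = V" by (auto simp: V_def image_Un image_image NN simp del: map_map)
  moreover have "finite V" "[] \<notin> V" using W by (auto simp: V_def)
  ultimately show thesis using that cov s1 s2 by blast
qed

section \<open>Exponential moments of the excess of zeros\<close>

primrec excess :: "bool list \<Rightarrow> real" where
  "excess [] = 0"
| "excess (d # w) = (if d then -1 else 1) + excess w"

lemma excess_append: "excess (u @ w) = excess u + excess w"
  by (induction u) auto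

lemma excess_flip: "excess (map Not w) = - excess w"
  by (induction w) auto

lemma abs_excess_le: "\<bar>excess w\<bar> \<le> real (length w)"
  by (induction w) auto

lemma exp_le_quadratic: "exp t \<le> 1 + t + t\<^sup>2 / 2 * exp \<bar>t\<bar>" for t :: real
proof -
  obtain s where s: "\<bar>s\<bar> \<le> \<bar>t\<bar>" "exp t = (\<Sum>m<2. t ^ m / fact m) + exp s / fact 2 * t ^ 2"
    using Maclaurin_exp_le[of t 2] by blast
  have "exp s * t\<^sup>2 \<le> exp \<bar>t\<bar> * t\<^sup>2" using s(1) by (intro mult_right_mono) auto
  then show ?thesis using s(2) by (simp add: numeral_2_eq_2 field_simps)
qed

text \<open>
  With \<open>\<theta>0 = ln \<beta> / 8\<close>, weights decay like \<open>exp (- 8 \<theta>0 |w|)\<close>, and the uniform bound on the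
  sum of their powers \<open>3/4\<close> leaves room for a factor \<open>exp (2 \<theta>0 |w|)\<close>. One half of this absorbs \<open>exp (\<theta> |w|)\<close>
  and the other half absorbs \<open>|w|\<^sup>2\<close>.
\<close>

definition \<theta>0 :: real where "\<theta>0 = ln \<beta> / 8"
definition M0 :: real where "M0 = K0 / \<theta>0\<^sup>2"

lemma theta0_pos: "0 < \<theta>0" using gt1 by (simp add: \<theta>0_def)

lemma K0_pos: "0 < K0" using D0_pos L_pos by (simp add: K0_def)

lemma M0_pos: "0 < M0" using theta0_pos K0_pos by (simp add: M0_def)

lemma wt_exp: "wt w = exp (- (8 * \<theta>0 * real (length w)))"
proof -
  have "\<beta> ^ length w = exp (ln \<beta> * real (length w))"
    using gt1 unfolding exp_of_nat2_mult by simp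
  then show ?thesis by (simp add: wt_def \<theta>0_def exp_minus inverse_eq_divide)
qed

lemma wt_powr: "wt w powr c = exp (- (8 * c * \<theta>0 * real (length w)))"
  by (simp add: wt_exp powr_def algebra_simps)

lemma quadratic_remainder:
  assumes "\<bar>\<theta>\<bar> \<le> \<theta>0"
  shows "wt w * ((\<theta> * excess w)\<^sup>2 / 2 * exp \<bar>\<theta> * excess w\<bar>) \<le> \<theta>\<^sup>2 / \<theta>0\<^sup>2 * wt w powr (3 / 4)"
proof -
  define l where "l = real (length w)"
  have b: "\<bar>excess w\<bar> \<le> l" using abs_excess_le by (simp add: l_def)
  have "\<bar>\<theta> * excess w\<bar> \<le> \<theta>0 * l"
    using assms b unfolding abs_mult by (intro mult_mono) auto
  moreover have "(\<theta> * excess w)\<^sup>2 \<le> \<theta>\<^sup>2 * l\<^sup>2"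
    using power_mono[OF b, of 2] by (simp add: power_mult_distrib mult_left_mono)
  ultimately have "(\<theta> * excess w)\<^sup>2 / 2 * exp \<bar>\<theta> * excess w\<bar> \<le> (\<theta>\<^sup>2 * l\<^sup>2) / 2 * exp (\<theta>0 * l)"
    by (intro mult_mono divide_right_mono) auto
  also have "\<dots> = \<theta>\<^sup>2 / \<theta>0\<^sup>2 * ((\<theta>0 * l)\<^sup>2 / 2 * exp (\<theta>0 * l))"
    using theta0_pos by (simp add: power_mult_distrib field_simps)
  also have "\<dots> \<le> \<theta>\<^sup>2 / \<theta>0\<^sup>2 * (exp (\<theta>0 * l) * exp (\<theta>0 * l))"
  proof (intro mult_left_mono mult_right_mono)
    have "0 \<le> \<theta>0 * l" using theta0_pos by (simp add: l_def)
    then show "(\<theta>0 * l)\<^sup>2 / 2 \<le> exp (\<theta>0 * l)"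
      using exp_lower_Taylor_quadratic[of "\<theta>0 * l"] by linarith
  qed auto
  finally have "wt w * ((\<theta> * excess w)\<^sup>2 / 2 * exp \<bar>\<theta> * excess w\<bar>)
      \<le> wt w * (\<theta>\<^sup>2 / \<theta>0\<^sup>2 * (exp (\<theta>0 * l) * exp (\<theta>0 * l)))"
    using wt_pos[of w] by (intro mult_left_mono) auto
  also have "\<dots> = \<theta>\<^sup>2 / \<theta>0\<^sup>2 * wt w powr (3 / 4)"
    unfolding wt_powr unfolding wt_exp l_def[symmetric] by (simp add: exp_add[symmetric])
  finally show ?thesis .
qed

definition symmetric_covers :: "(nat \<Rightarrow> bool list set) \<Rightarrow> bool" where
  "symmetric_covers V \<longleftrightarrow> (\<forall>i. finite (V i) \<and> [] \<notin> V i \<and> map Not ` V i = V i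
     \<and> {0..L} \<subseteq> (\<Union>w\<in>V i. cylinder w)
     \<and> (\<Sum>w\<in>V i. wt w) \<le> 1 + (1 / 2) ^ i \<and> (\<Sum>w\<in>V i. wt w powr (3 / 4)) \<le> K0)"

lemma symmetric_covers_exist: "\<exists>V. symmetric_covers V"
proof -
  have "\<forall>i. \<exists>V. finite V \<and> [] \<notin> V \<and> map Not ` V = V \<and> {0..L} \<subseteq> (\<Union>w\<in>V. cylinder w)
     \<and> (\<Sum>w\<in>V. wt w) \<le> 1 + (1 / 2) ^ i \<and> (\<Sum>w\<in>V. wt w powr (3 / 4)) \<le> K0"
  proof
    fix i :: nat
    have "(0 :: real) < (1 / 2) ^ i" by simp
    then obtain V where "finite V" "[] \<notin> V" "map Not ` V = V" "{0..L} \<subseteq> (\<Union>w\<in>V. cylinder w)"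
      "(\<Sum>w\<in>V. wt w) \<le> 1 + (1 / 2) ^ i" "(\<Sum>w\<in>V. wt w powr (3 / 4)) \<le> K0"
      by (rule symmetric_cover)
    then show "\<exists>V. finite V \<and> [] \<notin> V \<and> map Not ` V = V \<and> {0..L} \<subseteq> (\<Union>w\<in>V. cylinder w)
     \<and> (\<Sum>w\<in>V. wt w) \<le> 1 + (1 / 2) ^ i \<and> (\<Sum>w\<in>V. wt w powr (3 / 4)) \<le> K0" by blast
  qed
  then show ?thesis unfolding symmetric_covers_def by (rule choice)
qed

text \<open>
  By symmetry the linear term of \<open>exp (\<theta> excess)\<close> cancels, so the exponential moment exceeds the total
  weight only by a term of order \<open>\<theta>\<^sup>2\<close>, with a constant that is the same for all covers.
\<close>

lemma exponential_moment:
  assumes "symmetric_covers V" "\<bar>\<theta>\<bar> \<le> \<theta>0"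
  shows "(\<Sum>w\<in>V i. wt w * exp (\<theta> * excess w)) \<le> 1 + (1 / 2) ^ i + \<theta>\<^sup>2 * M0"
proof -
  have V: "finite (V i)" "map Not ` V i = V i" "(\<Sum>w\<in>V i. wt w) \<le> 1 + (1 / 2) ^ i"
    "(\<Sum>w\<in>V i. wt w powr (3 / 4)) \<le> K0"
    using assms(1) by (auto simp: symmetric_covers_def)
  have inj: "inj_on (map Not) (V i)" by (rule inj_on_subset[OF inj_mapI]) (auto simp: inj_def)
  have "(\<Sum>w\<in>V i. wt w * excess w) = (\<Sum>w\<in>map Not ` V i. wt w * excess w)" by (simp only: V(2))
  also have "\<dots> = (\<Sum>w\<in>V i. wt (map Not w) * excess (map Not w))"
    using sum.reindex[OF inj] by simp
  also have "\<dots> = - (\<Sum>w\<in>V i. wt w * excess w)"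
    by (simp add: excess_flip wt_def sum_negf)
  finally have odd: "(\<Sum>w\<in>V i. wt w * excess w) = 0" by simp
  have "(\<Sum>w\<in>V i. wt w * exp (\<theta> * excess w))
      \<le> (\<Sum>w\<in>V i. wt w + \<theta> * (wt w * excess w) + \<theta>\<^sup>2 / \<theta>0\<^sup>2 * wt w powr (3 / 4))"
  proof (rule sum_mono)
    fix w
    have "wt w * exp (\<theta> * excess w)
        \<le> wt w * (1 + \<theta> * excess w + (\<theta> * excess w)\<^sup>2 / 2 * exp \<bar>\<theta> * excess w\<bar>)"
      using exp_le_quadratic wt_pos[of w] by (intro mult_left_mono) auto
    also have "\<dots> = wt w + \<theta> * (wt w * excess w) + wt w * ((\<theta> * excess w)\<^sup>2 / 2 * exp \<bar>\<theta> * excess w\<bar>)"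
      by (simp add: algebra_simps)
    also have "\<dots> \<le> wt w + \<theta> * (wt w * excess w) + \<theta>\<^sup>2 / \<theta>0\<^sup>2 * wt w powr (3 / 4)"
      using quadratic_remainder[OF assms(2)] by (intro add_left_mono)
    finally show "wt w * exp (\<theta> * excess w)
        \<le> wt w + \<theta> * (wt w * excess w) + \<theta>\<^sup>2 / \<theta>0\<^sup>2 * wt w powr (3 / 4)" .
  qed
  also have "\<dots> = (\<Sum>w\<in>V i. wt w) + \<theta>\<^sup>2 / \<theta>0\<^sup>2 * (\<Sum>w\<in>V i. wt w powr (3 / 4))"
    unfolding sum.distrib sum_distrib_left[symmetric] odd by simp
  also have "\<dots> \<le> (1 + (1 / 2) ^ i) + \<theta>\<^sup>2 / \<theta>0\<^sup>2 * K0"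
    using V(3,4) by (intro add_mono mult_left_mono) auto
  finally show ?thesis by (simp add: M0_def)
qed

section \<open>Concatenated blocks\<close>

primrec concats :: "(nat \<Rightarrow> bool list set) \<Rightarrow> nat \<Rightarrow> bool list set" where
  "concats V 0 = {[]}"
| "concats V (Suc n) = (\<lambda>(u, w). u @ w) ` (concats V n \<times> V n)"

lemma finite_concats: "(\<And>i. finite (V i)) \<Longrightarrow> finite (concats V n)"
  by (induction n) auto

text \<open>
  Different pairs may have the same concatenation; for nonnegative \<open>f\<close> this can only decrease the left-hand
  side, hence the inequality.
\<close>

lemma sum_append_le:
  fixes f :: "bool list \<Rightarrow> real"
  assumes "finite A" "finite B" "\<And>w. 0 \<le> f w" "\<And>u w. f (u @ w) = f u * f w"
  shows "sum f ((\<lambda>(u, w). u @ w) ` (A \<times> B)) \<le> sum f A * sum f B"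
proof -
  have "sum f ((\<lambda>(u, w). u @ w) ` (A \<times> B)) \<le> (\<Sum>p\<in>A \<times> B. f ((\<lambda>(u, w). u @ w) p))"
    using sum_image_le[of "A \<times> B" f "\<lambda>(u, w). u @ w"] assms by (simp add: o_def)
  also have "\<dots> = (\<Sum>(u, w)\<in>A \<times> B. f u * f w)"
    by (intro sum.cong) (auto simp: assms(4))
  also have "\<dots> = sum f A * sum f B"
    by (simp add: sum_product sum.cartesian_product)
  finally show ?thesis .
qed

lemma sum_concats_le:
  fixes f :: "bool list \<Rightarrow> real"
  assumes "\<And>i. finite (V i)" "\<And>w. 0 \<le> f w" "\<And>u w. f (u @ w) = f u * f w" "f [] = 1"
  shows "sum f (concats V n) \<le> (\<Prod>i<n. sum f (V i))"
proof (induction n)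
  case (Suc n)
  have "sum f (concats V (Suc n)) \<le> sum f (concats V n) * sum f (V n)"
    using sum_append_le[of "concats V n" "V n" f] assms finite_concats[of V] by simp
  also have "\<dots> \<le> (\<Prod>i<n. sum f (V i)) * sum f (V n)"
    using Suc assms(2) by (intro mult_right_mono sum_nonneg) auto
  finally show ?case by (simp add: mult.commute)
qed (simp add: assms(4))

text \<open>
  The wastes \<open>2 ^ -i\<close> have sum at most \<open>2\<close>, so over \<open>n\<close> blocks they cost only a constant factor.
\<close>

lemma concats_exponential_moment:
  assumes "symmetric_covers V" "\<bar>\<theta>\<bar> \<le> \<theta>0"
  shows "(\<Sum>u\<in>concats V n. wt u * exp (\<theta> * excess u)) \<le> exp (2 + real n * (\<theta>\<^sup>2 * M0))"
proof -
  have "(\<Sum>u\<in>concats V n. wt u * exp (\<theta> * excess u)) \<le> (\<Prod>i<n. \<Sum>w\<in>V i. wt w * exp (\<theta> * excess w))"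
    using assms(1) wt_pos
    by (intro sum_concats_le) (auto simp: symmetric_covers_def less_imp_le wt_append excess_append
          distrib_left exp_add)
  also have "\<dots> \<le> (\<Prod>i<n. exp ((1 / 2) ^ i + \<theta>\<^sup>2 * M0))"
  proof (rule prod_mono)
    fix i
    have "(\<Sum>w\<in>V i. wt w * exp (\<theta> * excess w)) \<le> 1 + ((1 / 2) ^ i + \<theta>\<^sup>2 * M0)"
      using exponential_moment[OF assms, of i] by simp
    also have "\<dots> \<le> exp ((1 / 2) ^ i + \<theta>\<^sup>2 * M0)" by (rule exp_ge_add_one_self)
    finally show "0 \<le> (\<Sum>w\<in>V i. wt w * exp (\<theta> * excess w)) \<and>
        (\<Sum>w\<in>V i. wt w * exp (\<theta> * excess w)) \<le> exp ((1 / 2) ^ i + \<theta>\<^sup>2 * M0)"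
      using wt_pos by (auto intro!: sum_nonneg simp: less_imp_le)
  qed
  also have "\<dots> = exp ((\<Sum>i<n. (1 / 2) ^ i) + real n * (\<theta>\<^sup>2 * M0))"
    by (simp add: exp_sum[symmetric] sum.distrib)
  also have "(\<Sum>i<n. (1 / 2 :: real) ^ i) \<le> 2"
    by (simp add: sum_gp_strict)
  finally show ?thesis by simp
qed

section \<open>Almost every point avoids the bad cylinders\<close>

lemma AE_finitely_many_cylinders:
  assumes "\<And>n. finite (X n)" "\<And>n. (\<Sum>u\<in>X n. wt u) \<le> c n" "summable c"
  shows "AE x in lborel. eventually (\<lambda>n. x \<notin> (\<Union>u\<in>X n. cylinder u)) sequentially"
proof -
  define A where "A n = (\<Union>u\<in>X n. cylinder u)" for n
  have mc: "measure lborel (cylinder u) = L * wt u" for u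
    using L_pos wt_pos[of u] by (simp add: cylinder_interval less_imp_le)
  have sets: "A n \<in> sets lborel" for n
    using assms(1) by (auto simp: A_def cylinder_interval)
  have fin: "emeasure lborel (A n) < \<infinity>" for n
  proof -
    have "bounded (A n)" using assms(1) by (auto simp: A_def cylinder_interval)
    then show ?thesis by (rule emeasure_bounded_finite)
  qed
  have le: "measure lborel (A n) \<le> L * c n" for n
  proof -
    have "measure lborel (A n) \<le> (\<Sum>u\<in>X n. measure lborel (cylinder u))"
      unfolding A_def using assms(1)
      by (intro measure_UNION_le) (auto simp: cylinder_interval)
    also have "\<dots> = L * (\<Sum>u\<in>X n. wt u)" by (simp add: mc sum_distrib_left)
    also have "\<dots> \<le> L * c n" using assms(2) L_pos by (intro mult_left_mono) auto
    finally show ?thesis .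
  qed
  have "summable (\<lambda>n. measure lborel (A n))"
    using le by (intro summable_comparison_test'[OF summable_mult[OF assms(3), of L], of 0]) auto
  from borel_cantelli_AE1[OF sets fin this]
  show ?thesis by (simp add: A_def)
qed

definition unbalanced :: "(nat \<Rightarrow> bool list set) \<Rightarrow> real \<Rightarrow> nat \<Rightarrow> bool list set" where
  "unbalanced V \<epsilon> n = {u \<in> concats V n. \<epsilon> * real n < \<bar>excess u\<bar>}"

definition long_step :: "(nat \<Rightarrow> bool list set) \<Rightarrow> real \<Rightarrow> nat \<Rightarrow> bool list set" where
  "long_step V \<epsilon> n = (\<lambda>(u, w). u @ w) ` (concats V n \<times> {w \<in> V n. \<epsilon> * real n < real (length w)})"

text \<open>
  Chernoff's bound: a word with \<open>|excess| > \<epsilon> n\<close> satisfies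
  \<open>1 \<le> (exp (\<theta> excess) + exp (- \<theta> excess)) exp (- \<theta> \<epsilon> n)\<close>. The sum of the right-hand sides is at most
  \<open>2 exp (2 + n (\<theta>\<^sup>2 M0 - \<theta> \<epsilon>))\<close>, which decays geometrically once \<open>\<theta> M0 \<le> \<epsilon> / 2\<close>.
\<close>

lemma AE_unbalanced:
  assumes V: "symmetric_covers V" and "0 < \<epsilon>"
  shows "AE x in lborel. eventually (\<lambda>n. x \<notin> (\<Union>u\<in>unbalanced V \<epsilon> n. cylinder u)) sequentially"
proof (rule AE_finitely_many_cylinders)
  have finV: "finite (V i)" for i using V by (simp add: symmetric_covers_def)
  show "finite (unbalanced V \<epsilon> n)" for n using finite_concats[of V] finV by (simp add: unbalanced_def)
  define \<theta> where "\<theta> = min \<theta>0 (\<epsilon> / (2 * M0))"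
  have th: "0 < \<theta>" "\<theta> \<le> \<theta>0" "\<theta> * M0 \<le> \<epsilon> / 2"
    using theta0_pos M0_pos \<open>0 < \<epsilon>\<close> by (auto simp: \<theta>_def min_def field_simps)
  have th2: "\<theta>\<^sup>2 * M0 \<le> \<theta> * \<epsilon> / 2"
    using mult_left_mono[OF th(3), of \<theta>] th(1) by (simp add: power2_eq_square mult.assoc)
  show "(\<Sum>u\<in>unbalanced V \<epsilon> n. wt u) \<le> 2 * exp 2 * exp (- (\<theta> * \<epsilon> / 2)) ^ n" for n
  proof -
    have "(\<Sum>u\<in>unbalanced V \<epsilon> n. wt u)
        \<le> (\<Sum>u\<in>unbalanced V \<epsilon> n. (wt u * exp (\<theta> * excess u) + wt u * exp (- \<theta> * excess u)) * exp (- \<theta> * (\<epsilon> * n)))"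
    proof (rule sum_mono)
      fix u assume "u \<in> unbalanced V \<epsilon> n"
      then have "\<epsilon> * n < \<bar>excess u\<bar>" by (simp add: unbalanced_def)
      then have "\<theta> * (\<epsilon> * n) \<le> \<theta> * \<bar>excess u\<bar>" using th by (intro mult_left_mono) auto
      then have "1 \<le> exp (\<theta> * \<bar>excess u\<bar> + - \<theta> * (\<epsilon> * n))" by simp
      also have "\<dots> = exp (\<theta> * \<bar>excess u\<bar>) * exp (- \<theta> * (\<epsilon> * n))" by (rule exp_add)
      also have "\<dots> \<le> (exp (\<theta> * excess u) + exp (- \<theta> * excess u)) * exp (- \<theta> * (\<epsilon> * n))"
        by (intro mult_right_mono) (auto simp: abs_if)
      finally have "1 \<le> (exp (\<theta> * excess u) + exp (- \<theta> * excess u)) * exp (- \<theta> * (\<epsilon> * n))" .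
      from mult_left_mono[OF this, of "wt u"]
      show "wt u \<le> (wt u * exp (\<theta> * excess u) + wt u * exp (- \<theta> * excess u)) * exp (- \<theta> * (\<epsilon> * n))"
        using wt_pos[of u] by (simp add: algebra_simps)
    qed
    also have "\<dots> \<le> (\<Sum>u\<in>concats V n. (wt u * exp (\<theta> * excess u) + wt u * exp (- \<theta> * excess u)) * exp (- \<theta> * (\<epsilon> * n)))"
      using finite_concats[of V] finV wt_pos
      by (intro sum_mono2) (auto simp: unbalanced_def less_imp_le)
    also have "\<dots> = ((\<Sum>u\<in>concats V n. wt u * exp (\<theta> * excess u))
        + (\<Sum>u\<in>concats V n. wt u * exp (- \<theta> * excess u))) * exp (- \<theta> * (\<epsilon> * n))"
      by (simp add: sum_distrib_right[symmetric] sum.distrib)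
    also have "\<dots> \<le> (exp (2 + real n * (\<theta>\<^sup>2 * M0)) + exp (2 + real n * ((- \<theta>)\<^sup>2 * M0))) * exp (- \<theta> * (\<epsilon> * n))"
      using th by (intro mult_right_mono add_mono concats_exponential_moment[OF V]) auto
    also have "\<dots> = 2 * exp (2 + real n * (\<theta>\<^sup>2 * M0 - \<theta> * \<epsilon>))"
      by (simp add: exp_add[symmetric] algebra_simps)
    also have "\<dots> \<le> 2 * exp (2 + real n * (- (\<theta> * \<epsilon> / 2)))"
    proof -
      have "\<theta>\<^sup>2 * M0 - \<theta> * \<epsilon> \<le> - (\<theta> * \<epsilon> / 2)" using th2 by linarith
      from mult_left_mono[OF this, of "real n"] show ?thesis by simp
    qed
    also have "\<dots> = 2 * exp 2 * exp (- (\<theta> * \<epsilon> / 2)) ^ n"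
      unfolding exp_add exp_of_nat_mult by simp
    finally show ?thesis .
  qed
  show "summable (\<lambda>n. 2 * exp 2 * exp (- (\<theta> * \<epsilon> / 2)) ^ n)"
    using th \<open>0 < \<epsilon>\<close> by (intro summable_mult summable_geometric) auto
qed

text \<open>
  A block with \<open>|w| > \<epsilon> n\<close> has weight at most \<open>exp (- 2 \<theta>0 \<epsilon> n)\<close> times the power \<open>3/4\<close> of its weight, and
  those powers have a bounded sum.
\<close>

lemma AE_long_step:
  assumes V: "symmetric_covers V" and "0 < \<epsilon>"
  shows "AE x in lborel. eventually (\<lambda>n. x \<notin> (\<Union>u\<in>long_step V \<epsilon> n. cylinder u)) sequentially"
proof (rule AE_finitely_many_cylinders)
  have finV: "finite (V i)" for i using V by (simp add: symmetric_covers_def)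
  show "finite (long_step V \<epsilon> n)" for n using finite_concats[of V] finV by (simp add: long_step_def)
  show "(\<Sum>u\<in>long_step V \<epsilon> n. wt u) \<le> exp 2 * K0 * exp (- (2 * \<theta>0 * \<epsilon>)) ^ n" for n
  proof -
    define W where "W = {w \<in> V n. \<epsilon> * real n < real (length w)}"
    have "(\<Sum>w\<in>W. wt w) \<le> (\<Sum>w\<in>W. wt w powr (3 / 4) * exp (- (2 * \<theta>0 * \<epsilon>)) ^ n)"
    proof (rule sum_mono)
      fix w assume "w \<in> W"
      then have "2 * \<theta>0 * (\<epsilon> * real n) \<le> 2 * \<theta>0 * real (length w)"
        using theta0_pos by (intro mult_left_mono) (auto simp: W_def)
      then have "wt w \<le> wt w powr (3 / 4) * exp (real n * (- (2 * \<theta>0 * \<epsilon>)))"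
        unfolding wt_powr unfolding wt_exp by (simp add: exp_add[symmetric] algebra_simps)
      then show "wt w \<le> wt w powr (3 / 4) * exp (- (2 * \<theta>0 * \<epsilon>)) ^ n"
        by (simp only: exp_of_nat_mult)
    qed
    also have "\<dots> \<le> (\<Sum>w\<in>V n. wt w powr (3 / 4) * exp (- (2 * \<theta>0 * \<epsilon>)) ^ n)"
      using finV by (intro sum_mono2) (auto simp: W_def)
    also have "\<dots> = (\<Sum>w\<in>V n. wt w powr (3 / 4)) * exp (- (2 * \<theta>0 * \<epsilon>)) ^ n"
      by (simp add: sum_distrib_right)
    also have "\<dots> \<le> K0 * exp (- (2 * \<theta>0 * \<epsilon>)) ^ n"
      using V by (intro mult_right_mono) (auto simp: symmetric_covers_def)
    finally have W: "(\<Sum>w\<in>W. wt w) \<le> K0 * exp (- (2 * \<theta>0 * \<epsilon>)) ^ n" .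
    have "(\<Sum>u\<in>long_step V \<epsilon> n. wt u) \<le> (\<Sum>u\<in>concats V n. wt u) * (\<Sum>w\<in>W. wt w)"
      unfolding long_step_def W_def using finite_concats[of V] finV wt_pos
      by (intro sum_append_le) (auto simp: wt_append less_imp_le)
    also have "\<dots> \<le> exp 2 * (K0 * exp (- (2 * \<theta>0 * \<epsilon>)) ^ n)"
      using W concats_exponential_moment[OF V, of 0 n] theta0_pos wt_pos
      by (intro mult_mono) (auto intro!: sum_nonneg simp: less_imp_le)
    finally show ?thesis by (simp add: mult.assoc)
  qed
  show "summable (\<lambda>n. exp 2 * K0 * exp (- (2 * \<theta>0 * \<epsilon>)) ^ n)"
    using theta0_pos \<open>0 < \<epsilon>\<close> by (intro summable_mult summable_geometric) auto
qed

section \<open>Expansions composed of blocks\<close>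

lemma block_path:
  assumes V: "symmetric_covers V" and x: "x \<in> {0..L}"
  obtains w y where "y 0 = x" "\<And>n. w n \<in> V n" "\<And>n. y n \<in> {0..L}" "\<And>n. y n = cyl (w n) (y (Suc n))"
proof -
  have "\<exists>y. \<forall>n. (y n \<in> {0..L} \<and> (n = 0 \<longrightarrow> y n = x)) \<and> (\<exists>w\<in>V n. y n = cyl w (y (Suc n)))"
  proof (rule dependent_nat_choice)
    fix s and n :: nat
    assume "s \<in> {0..L} \<and> (n = 0 \<longrightarrow> s = x)"
    moreover have "{0..L} \<subseteq> (\<Union>w\<in>V n. cylinder w)" using V by (simp add: symmetric_covers_def)
    ultimately obtain w where "w \<in> V n" "s \<in> cylinder w" by blast
    then show "\<exists>t. (t \<in> {0..L} \<and> (Suc n = 0 \<longrightarrow> t = x)) \<and> (\<exists>w\<in>V n. s = cyl w t)"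
      by (auto simp: cylinder_def)
  qed (use x in auto)
  then obtain y where y: "\<And>n. y n \<in> {0..L}" "y 0 = x" "\<And>n. \<exists>w\<in>V n. y n = cyl w (y (Suc n))"
    by blast
  then have "\<forall>n. \<exists>w. w \<in> V n \<and> y n = cyl w (y (Suc n))" by blast
  then obtain w where "\<forall>n. w n \<in> V n \<and> y n = cyl (w n) (y (Suc n))" by metis
  then show thesis using that[of y w] y by blast
qed

definition joined :: "(nat \<Rightarrow> bool list) \<Rightarrow> nat \<Rightarrow> bool list" where
  "joined w n = concat (map w [0..<n])"

lemma joined_simps [simp]: "joined w 0 = []" "joined w (Suc n) = joined w n @ w n"
  by (simp_all add: joined_def)

lemma joined_prefix: "m \<le> n \<Longrightarrow> \<exists>v. joined w n = joined w m @ v"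
  by (induction n rule: dec_induct) auto

lemma length_joined_mono: "m \<le> n \<Longrightarrow> length (joined w m) \<le> length (joined w n)"
  using joined_prefix[of m n w] by auto

lemma length_joined_ge:
  assumes "\<And>n. w n \<noteq> []" shows "n \<le> length (joined w n)"
proof (induction n)
  case (Suc n)
  then show ?case using assms[of n] by (cases "w n") auto
qed simp

lemma joined_nth:
  assumes "i < length (joined w m)" "i < length (joined w n)"
  shows "joined w m ! i = joined w n ! i"
proof (cases "m \<le> n")
  case True
  then show ?thesis using joined_prefix[of m n w] assms by (auto simp: nth_append)
next
  case False
  then show ?thesis using joined_prefix[of n m w] assms by (auto simp: nth_append)
qed

text \<open>
  The first \<open>i + 1\<close> blocks already determine the digit at position \<open>i\<close>, because blocks are nonempty.
\<close>

definition stream_digit :: "(nat \<Rightarrow> bool list) \<Rightarrow> nat \<Rightarrow> bool" where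
  "stream_digit w i = joined w (Suc i) ! i"

lemma map_stream_digit:
  assumes "\<And>n. w n \<noteq> []" "N \<le> length (joined w n)"
  shows "map (stream_digit w) [0..<N] = take N (joined w n)"
proof (rule nth_equalityI)
  fix i assume "i < length (map (stream_digit w) [0..<N])"
  then have i: "i < N" by simp
  have "i < length (joined w (Suc i))" using length_joined_ge[of w "Suc i"] assms(1) by simp
  then have "stream_digit w i = joined w n ! i"
    unfolding stream_digit_def using i assms(2) by (intro joined_nth) auto
  then show "map (stream_digit w) [0..<N] ! i = take N (joined w n) ! i"
    using i assms(2) by simp
qed (use assms(2) in simp)

text \<open>
  The blocks may be chosen arbitrarily, since bad cylinders are avoided for all words at once. If the first \<open>N\<close>
  digits end inside the block following the first \<open>n\<close> blocks, then their excess is at most \<open>\<epsilon> n\<close> from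
  the complete blocks plus \<open>\<epsilon> n\<close> from the length of the unfinished one, and \<open>n \<le> N\<close> because every
  block contains a digit.
\<close>

lemma balanced_expansion:
  assumes V: "symmetric_covers V" and x: "x \<in> {0..L}"
    and unb: "\<And>k. eventually (\<lambda>n. x \<notin> (\<Union>u\<in>unbalanced V (1 / real (Suc k)) n. cylinder u)) sequentially"
    and lng: "\<And>k. eventually (\<lambda>n. x \<notin> (\<Union>u\<in>long_step V (1 / real (Suc k)) n. cylinder u)) sequentially"
  obtains e where "\<And>N. x \<in> cylinder (map e [0..<N])" "(\<lambda>N. excess (map e [0..<N]) / real N) \<longlonglongrightarrow> 0"
proof -
  obtain w y where w: "y 0 = x" "\<And>n. w n \<in> V n" "\<And>n. y n \<in> {0..L}"
      "\<And>n. y n = cyl (w n) (y (Suc n))"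
    using block_path[OF V x] by blast
  have ne: "w n \<noteq> []" for n using V w(2)[of n] by (auto simp: symmetric_covers_def)
  define U where "U = joined w"
  define e where "e = stream_digit w"
  have U_concats: "U n \<in> concats V n" for n
  proof (induction n)
    case (Suc n)
    then show ?case using w(2)[of n] by (auto simp: U_def image_iff intro!: bexI[of _ "(joined w n, w n)"])
  qed (simp add: U_def)
  have U_path: "x = cyl (U n) (y n)" for n
  proof (induction n)
    case (Suc n)
    have "cyl (U (Suc n)) (y (Suc n)) = cyl (U n) (cyl (w n) (y (Suc n)))"
      by (simp add: U_def cyl_append)
    also have "\<dots> = x" using Suc w(4)[of n] by simp
    finally show ?case by simp
  qed (simp add: U_def w(1))
  have U_mem: "x \<in> cylinder (U n)" for n
    using U_path[of n] w(3)[of n] by (auto simp: cylinder_def)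
  have geU: "n \<le> length (U n)" for n unfolding U_def using length_joined_ge ne by blast
  have pre: "map e [0..<N] = take N (U n)" if "N \<le> length (U n)" for N n
    using map_stream_digit[of w N n] ne that by (simp add: U_def e_def)
  have mem: "x \<in> cylinder (map e [0..<N])" for N
  proof -
    have "x = cyl (take N (U N) @ drop N (U N)) (y N)" using U_path by simp
    then have "x = cyl (map e [0..<N]) (cyl (drop N (U N)) (y N))"
      using pre[OF geU] by (simp only: cyl_append)
    moreover have "cyl (drop N (U N)) (y N) \<in> {0..L}" using w(3) by (rule cyl_mem)
    ultimately show ?thesis unfolding cylinder_def by blast
  qed
  have "(\<lambda>N. excess (map e [0..<N]) / real N) \<longlonglongrightarrow> 0"
  proof (rule LIMSEQ_I)
    fix r :: real assume r: "0 < r"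
    obtain k where k: "1 / real (Suc k) < r / 2" using nat_approx_posE[of "r / 2"] r by auto
    define \<epsilon> where "\<epsilon> = 1 / real (Suc k)"
    have "eventually (\<lambda>n. x \<notin> (\<Union>u\<in>unbalanced V \<epsilon> n. cylinder u) \<and> x \<notin> (\<Union>u\<in>long_step V \<epsilon> n. cylinder u)) sequentially"
      using unb[of k] lng[of k] unfolding \<epsilon>_def by (rule eventually_conj)
    then obtain n0 where n0: "\<And>n. n \<ge> n0 \<Longrightarrow> x \<notin> (\<Union>u\<in>unbalanced V \<epsilon> n. cylinder u)"
        "\<And>n. n \<ge> n0 \<Longrightarrow> x \<notin> (\<Union>u\<in>long_step V \<epsilon> n. cylinder u)"
      unfolding eventually_sequentially by blast
    have excessU: "\<bar>excess (U n)\<bar> \<le> \<epsilon> * real n" if "n \<ge> n0" for n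
    proof (rule ccontr)
      assume "\<not> ?thesis"
      then have "U n \<in> unbalanced V \<epsilon> n" using U_concats by (simp add: unbalanced_def)
      then show False using n0(1)[OF that] U_mem by blast
    qed
    have lenw: "real (length (w n)) \<le> \<epsilon> * real n" if "n \<ge> n0" for n
    proof (rule ccontr)
      assume "\<not> ?thesis"
      then have "(U n, w n) \<in> concats V n \<times> {v \<in> V n. \<epsilon> * real n < real (length v)}"
        using U_concats w(2) by simp
      then have "U n @ w n \<in> long_step V \<epsilon> n" unfolding long_step_def by (rule rev_image_eqI) simp
      then have "U (Suc n) \<in> long_step V \<epsilon> n" by (simp add: U_def)
      then show False using n0(2)[OF that] U_mem by blast
    qed
    have "norm (excess (map e [0..<N]) / real N - 0) < r" if N: "N \<ge> Suc (length (U n0))" for N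
    proof -
      \<comment> \<open>The first \<open>N\<close> digits contain all of the first \<open>m - 1\<close> blocks, but not all of the \<open>m\<close>-th.\<close>
      define m where "m = (LEAST m. N < length (U m))"
      have ex: "N < length (U (Suc N))" using geU[of "Suc N"] by simp
      then have m: "N < length (U m)" unfolding m_def by (rule LeastI)
      then have "m \<noteq> 0" by (auto simp: U_def intro!: Nat.gr0I)
      then obtain n where n: "m = Suc n" by (cases m) auto
      have le: "length (U n) \<le> N"
        using not_less_Least[of n "\<lambda>m. N < length (U m)"] n m_def by simp
      have "\<not> m \<le> n0"
        using m N length_joined_mono[of m n0 w] by (auto simp: U_def)
      then have nn0: "n \<ge> n0" using n by simp
      have nN: "real n \<le> real N" using geU[of n] le by simp
      have "map e [0..<N] = U n @ take (N - length (U n)) (w n)"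
        using pre[of N m] m le by (simp add: n U_def)
      then have "\<bar>excess (map e [0..<N])\<bar> \<le> \<bar>excess (U n)\<bar> + \<bar>excess (take (N - length (U n)) (w n))\<bar>"
        by (simp add: excess_append)
      also have "\<bar>excess (take (N - length (U n)) (w n))\<bar> \<le> real (length (w n))"
        using abs_excess_le[of "take (N - length (U n)) (w n)"] by simp
      also have "\<bar>excess (U n)\<bar> + real (length (w n)) \<le> 2 * (\<epsilon> * real n)"
        using excessU[OF nn0] lenw[OF nn0] by simp
      also have "\<dots> \<le> 2 * (\<epsilon> * real N)"
        using nN by (intro mult_left_mono) (auto simp: \<epsilon>_def)
      also have "\<dots> < r * real N"
      proof -
        have "2 * \<epsilon> < r" using k unfolding \<epsilon>_def by linarith
        then show ?thesis using N by simp
      qed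
      finally show ?thesis using N by (simp add: divide_less_eq)
    qed
    then show "\<exists>no. \<forall>N\<ge>no. norm (excess (map e [0..<N]) / real N - 0) < r" by blast
  qed
  then show thesis using that mem by blast
qed

section \<open>Sums and digit frequencies\<close>

lemma cyl_zero_sum: "cyl (map e [0..<N]) 0 = (\<Sum>i<N. of_bool (e i) / \<beta> ^ Suc i)"
proof (induction N)
  case (Suc N)
  have "cyl (map e [0..<Suc N]) 0 = cyl (map e [0..<N]) (of_bool (e N) / \<beta>)"
    by (simp add: cyl_append)
  then show ?case using Suc cyl_affine[of "map e [0..<N]" "of_bool (e N) / \<beta>"]
    by (simp add: wt_def)
qed simp

lemma sums_if_in_cylinders:
  assumes "\<And>N. x \<in> cylinder (map e [0..<N])"
  shows "(\<lambda>i. of_bool (e i) / \<beta> ^ Suc i) sums x"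
  unfolding sums_def
proof (rule LIMSEQ_I)
  fix r :: real assume r: "0 < r"
  obtain k where k: "L / r < \<beta> ^ k" using real_arch_pow[OF gt1] by blast
  have "norm ((\<Sum>i<N. of_bool (e i) / \<beta> ^ Suc i) - x) < r" if N: "N \<ge> k" for N
  proof -
    have "L / r < \<beta> ^ N" using k power_increasing[OF N, of \<beta>] gt1 by linarith
    then have "L / \<beta> ^ N < r" using r beta_pos by (simp add: field_simps)
    moreover have "\<bar>cyl (map e [0..<N]) 0 - x\<bar> \<le> L / \<beta> ^ N"
      using assms[of N] unfolding cylinder_interval by (auto simp: wt_def)
    ultimately show ?thesis unfolding cyl_zero_sum by simp
  qed
  then show "\<exists>no. \<forall>N\<ge>no. norm ((\<Sum>i<N. of_bool (e i) / \<beta> ^ Suc i) - x) < r" by blast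
qed

text \<open>
  The digit sequence of an expansion starts at index \<open>1\<close>, that of \<open>e\<close> at index \<open>0\<close>; hence the shift.
\<close>

lemma card_zeros:
  "2 * real (card {i. 1 \<le> i \<and> i \<le> N \<and> of_bool (e (i - 1)) = (0 :: nat)})
     = real N + excess (map e [0..<N])"
proof (induction N)
  case (Suc N)
  let ?Z = "\<lambda>N. {i. 1 \<le> i \<and> i \<le> N \<and> of_bool (e (i - 1)) = (0 :: nat)}"
  have fin: "finite (?Z N)" by (rule finite_subset[of _ "{..N}"]) auto
  have "?Z (Suc N) = (if e N then ?Z N else insert (Suc N) (?Z N))"
    by (auto simp: le_Suc_eq)
  then have "real (card (?Z (Suc N))) = real (card (?Z N)) + (if e N then 0 else 1)"
    using fin by simp
  then show ?case using Suc by (simp add: excess_append)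
qed simp

lemma simply_normal_of_balanced:
  assumes "(\<lambda>N. excess (map e [0..<N]) / real N) \<longlonglongrightarrow> 0"
  shows "simply_normal (\<lambda>i. of_bool (e (i - 1)))"
  unfolding simply_normal_def has_zero_frequency_def
proof -
  have "(\<lambda>N. 1 / 2 + (excess (map e [0..<N]) / real N) / 2) \<longlonglongrightarrow> 1 / 2 + 0 / 2"
    by (intro tendsto_intros assms) auto
  then have lim: "(\<lambda>N. 1 / 2 + (excess (map e [0..<N]) / real N) / 2) \<longlonglongrightarrow> 1 / 2" by simp
  show "(\<lambda>N. real (card {i. 1 \<le> i \<and> i \<le> N \<and> of_bool (e (i - 1)) = (0 :: nat)}) / real N) \<longlonglongrightarrow> 1 / 2"
  proof (rule Lim_transform_eventually[OF lim])
    show "eventually (\<lambda>N. 1 / 2 + (excess (map e [0..<N]) / real N) / 2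
        = real (card {i. 1 \<le> i \<and> i \<le> N \<and> of_bool (e (i - 1)) = (0 :: nat)}) / real N) sequentially"
      using eventually_gt_at_top[of 0]
    proof eventually_elim
      case (elim N)
      then show ?case using card_zeros[of N e] by (simp add: field_simps)
    qed
  qed
qed

end

theorem theorem4p1:
  fixes \<beta> :: real
  assumes "1 < \<beta>" and "\<beta> < 2"
  shows "AE x in lebesgue. x \<in> beta_interval \<beta> \<longrightarrow>
           (\<exists>\<epsilon>. beta_expansion \<beta> x \<epsilon> \<and> simply_normal \<epsilon>)"
proof -
  interpret beta_base \<beta> using assms by unfold_locales
  obtain V where V: "symmetric_covers V" using symmetric_covers_exist by blast
  have "AE x in lborel. \<forall>k. eventually (\<lambda>n. x \<notin> (\<Union>u\<in>unbalanced V (1 / real (Suc k)) n. cylinder u)) sequentially"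
    unfolding AE_all_countable using AE_unbalanced[OF V] by simp
  moreover have "AE x in lborel. \<forall>k. eventually (\<lambda>n. x \<notin> (\<Union>u\<in>long_step V (1 / real (Suc k)) n. cylinder u)) sequentially"
    unfolding AE_all_countable using AE_long_step[OF V] by simp
  ultimately have "AE x in lborel. x \<in> beta_interval \<beta> \<longrightarrow>
           (\<exists>\<epsilon>. beta_expansion \<beta> x \<epsilon> \<and> simply_normal \<epsilon>)"
  proof eventually_elim
    case (elim x)
    show ?case
    proof
      assume "x \<in> beta_interval \<beta>"
      then have x: "x \<in> {0..L}" by (simp add: beta_interval_def L_def)
      obtain e where e: "\<And>N. x \<in> cylinder (map e [0..<N])"
          "(\<lambda>N. excess (map e [0..<N]) / real N) \<longlonglongrightarrow> 0"
        using balanced_expansion[OF V x] elim by blast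
      have "beta_expansion \<beta> x (\<lambda>i. of_bool (e (i - 1)))"
        using sums_if_in_cylinders[OF e(1)] by (simp add: beta_expansion_def binary_seq_def)
      then show "\<exists>\<epsilon>. beta_expansion \<beta> x \<epsilon> \<and> simply_normal \<epsilon>"
        using simply_normal_of_balanced[OF e(2)] by blast
    qed
  qed
  then show ?thesis by (rule AE_completion)
qed

end
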